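(* Suppose that the set $\mathcal X$ is MICP-R and the function $Q(\cdot,\boldsymbol\xi^i)$ is MICP-R for each $i\in[N]$. Let $\mathcal P=\{\boldsymbol p\in\mathbb R_+^N:\boldsymbol D\boldsymbol p\le\boldsymbol d,\ \boldsymbol e^\top\boldsymbol p=1\}$ be a polyhedral ambiguity set. Then the distributionally favorable optimization problem $$v^*=\min_{\boldsymbol x\in\mathcal X}\min_{\boldsymbol p\ge\boldsymbol0}\left\{\sum_{i\in[N]}p_iQ(\boldsymbol x,\boldsymbol\xi^i):\ \boldsymbol D\boldsymbol p\le\boldsymbol d,\ \boldsymbol e^\top\boldsymbol p=1\right\}$$ is MICP-R.
   Context: $[N]=\{1,\dots,N\}$. $\mathcal X\subseteq\mathbb R^n$ is compact with non-empty relative interior. The support $\{\boldsymbol\xi^1,\dots,\boldsymbol\xi^N\}\subset\mathbb R^m$ is finite, and probability distributions on it are identified with vectors $\boldsymbol p\in\mathbb R^N_+$. $Q(\boldsymbol x,\boldsymbol\xi)$ is real-valued; $Q(\cdot,\boldsymbol\xi^i)$ is considered as a function of $\boldsymbol x\in\mathcal X$. $\boldsymbol D\in\mathbb R^{\ell\times N}$, $\boldsymbol d\in\mathbb R^\ell$, and $\boldsymbol e$ is the all-ones vector. MICP-R (mixed-integer convex programming representable): a set $S\subseteq\mathbb R^n$ is MICP-R if there are integers $r,s$ and a closed convex set $M\subseteq\mathbb R^{n+r+s}$ such that $\boldsymbol x\in S$ if and only if there exist $\boldsymbol y\in\mathbb R^r$, $\boldsymbol z\in\mathbb Z^s$ with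 $(\boldsymbol x,\boldsymbol y,\boldsymbol z)\in M$. A function $f:S\to\mathbb R$ is MICP-R if both its domain $S$ and its epigraph $\{(\boldsymbol x,t):\boldsymbol x\in S,\ f(\boldsymbol x)\le t\}$ are MICP-R. A mathematical program is MICP-R if both its feasible region and its objective function (here, the function of $\boldsymbol x\in\mathcal X$ given by the inner minimum over $\boldsymbol p$) are MICP-R. *)

theory Defs
  imports "HOL-Analysis.Analysis"
begin

text \<open>
  The dimensions r and s of the auxiliary variables are quantified inside the definition of
  MICP-representability, so they cannot be type-level dimensions. They are rendered with the
  library's \<^const>\<open>Euclidean_space\<close>: the points of \<open>Euclidean_space k\<close> are the sequences
  \<open>nat \<Rightarrow> real\<close> that vanish from index k on, with the topology of k-dimensional space.
  As \<open>nat \<Rightarrow> real\<close> is not an instance of \<^class>\<open>real_vector\<close>, convexity of a set of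
  triples \<open>(x, y, z)\<close> is spelled out componentwise.
\<close>

definition convex_triples :: "('a::real_vector \<times> (nat \<Rightarrow> real) \<times> (nat \<Rightarrow> real)) set \<Rightarrow> bool" where
  "convex_triples M \<longleftrightarrow>
     (\<forall>x y z x' y' z' u v.
        (x, y, z) \<in> M \<longrightarrow> (x', y', z') \<in> M \<longrightarrow> 0 \<le> u \<longrightarrow> 0 \<le> v \<longrightarrow> u + v = 1 \<longrightarrow>
        (u *\<^sub>R x + v *\<^sub>R x', (\<lambda>j. u * y j + v * y' j), (\<lambda>j. u * z j + v * z' j)) \<in> M)"

text \<open>
  Note that \<^const>\<open>closedin\<close> also forces \<open>M\<close> to be a subset of the product of the ambient
  space with \<open>Euclidean_space r\<close> and \<open>Euclidean_space s\<close>.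
\<close>

definition micp_set :: "'a::euclidean_space set \<Rightarrow> bool" where
  "micp_set S \<longleftrightarrow>
     (\<exists>(r::nat) (s::nat) M.
        closedin (prod_topology euclidean (prod_topology (Euclidean_space r) (Euclidean_space s))) M \<and>
        convex_triples M \<and>
        (\<forall>x. x \<in> S \<longleftrightarrow> (\<exists>y z. (\<forall>j<s. z j \<in> \<int>) \<and> (x, y, z) \<in> M)))"

definition micp_fun :: "'a::euclidean_space set \<Rightarrow> ('a \<Rightarrow> real) \<Rightarrow> bool" where
  "micp_fun S f \<longleftrightarrow> micp_set S \<and> micp_set (epigraph S f)"

text \<open>A minimisation problem is given by its feasible region and its objective function.\<close>

definition micp_program :: "'a::euclidean_space set \<Rightarrow> ('a \<Rightarrow> real) \<Rightarrow> bool" where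
  "micp_program F f \<longleftrightarrow> micp_set F \<and> micp_fun F f"

definition ambiguity_set :: "real^'N^'l \<Rightarrow> real^'l \<Rightarrow> (real^'N) set" where
  "ambiguity_set D d = {p. 0 \<le> p \<and> D *v p \<le> d \<and> (\<Sum>i\<in>UNIV. p $ i) = 1}"

text \<open>
  The feasible region in the x-variables consists of those points of \<open>X\<close> for which the inner
  minimisation over p is feasible. It is \<open>X\<close> whenever the ambiguity set is nonempty, and it
  is empty otherwise, so the real infimum below is never taken over an empty set at a feasible
  point. The infimum is attained there, since the ambiguity set is compact.
\<close>

definition dfo_feasible :: "'a set \<Rightarrow> real^'N^'l \<Rightarrow> real^'l \<Rightarrow> 'a set" where
  "dfo_feasible X D d = {x \<in> X. \<exists>p. p \<in> ambiguity_set D d}"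

definition dfo_objective ::
    "('a \<Rightarrow> 'b \<Rightarrow> real) \<Rightarrow> ('N \<Rightarrow> 'b) \<Rightarrow> real^'N^'l \<Rightarrow> real^'l \<Rightarrow> 'a \<Rightarrow> real" where
  "dfo_objective Q \<xi> D d x = (INF p\<in>ambiguity_set D d. \<Sum>i\<in>UNIV. p $ i * Q x (\<xi> i))"

lemma dfo_feasible_eq:
  "ambiguity_set D d \<noteq> {} \<Longrightarrow> dfo_feasible X D d = X"
  by (auto simp: dfo_feasible_def)

end

theory Submission
  imports Defs
begin

text \<open>
  The ambiguity set is a polytope, so the inner minimum is attained at one of its finitely many
  vertices v, and the epigraph of the objective is the union over v of the sets
  \<open>{(x, t). \<exists>\<tau>. (\<forall>i. (x, \<tau>\<^sub>i) \<in> epi Q\<^sub>i) \<and> v \<bullet> \<tau> \<le> t}\<close>. It remains to see that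
  MICP-representable sets are closed under affine preimages, finite intersections, projections
  and finite unions. For a union of nonempty sets S and T no perspective functions or bounds are
  needed: x lies in the union iff there are \<open>a \<in> S\<close>, \<open>b \<in> T\<close>, v and an integer \<open>\<lambda>\<close> with
  \<open>\<parallel>x - a\<parallel>\<^sup>2 \<le> v \<lambda>\<close> and \<open>\<parallel>x - b\<parallel>\<^sup>2 \<le> v (1 - \<lambda>)\<close>, where both rotated cones are convex,
  \<open>\<lambda>\<close> is forced into \<open>{0, 1}\<close>, and v is free to relax the inactive constraint.
\<close>

subsection \<open>Closure properties of representable sets\<close>

text \<open>\<open>Euclidean_space k\<close> is a subspace of the product topology on sequences,
  which is the type-class topology of \<open>nat \<Rightarrow> real\<close>. Products of subspaces
  are subspaces of the product, so \<open>closedin\<close> can be traded for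
  \<open>closed\<close>.\<close>

lemma prod_topology_Euclidean_space:
  "prod_topology (euclidean :: 'a::euclidean_space topology)
     (prod_topology (Euclidean_space r) (Euclidean_space s)) =
   subtopology euclidean (UNIV \<times> {y. \<forall>j\<ge>r. y j = 0} \<times> {z. \<forall>j\<ge>s. z j = 0})"
proof -
  have "Euclidean_space k = subtopology euclidean {y. \<forall>j\<ge>k. y j = 0}" for k
    by (simp add: Euclidean_space_def euclidean_product_topology)
  then have "prod_topology (subtopology (euclidean :: 'a topology) UNIV)
      (prod_topology (Euclidean_space r) (Euclidean_space s)) =
    subtopology euclidean (UNIV \<times> {y. \<forall>j\<ge>r. y j = 0} \<times> {z. \<forall>j\<ge>s. z j = 0})"
    by (simp only: prod_topology_subtopology_eu)
  then show ?thesis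
    by (simp only: subtopology_UNIV)
qed

lemma closed_zero_from: "closed {y :: nat \<Rightarrow> real. \<forall>j\<ge>k. y j = 0}"
proof -
  have "closed {y :: nat \<Rightarrow> real. y j = 0}" for j
    by (intro closed_Collect_eq continuous_on_product_coordinates continuous_on_const)
  then have "closed (\<Inter>j\<in>{k..}. {y :: nat \<Rightarrow> real. y j = 0})"
    by (intro closed_INT) blast
  then show ?thesis
    by (simp add: Collect_ball_eq[symmetric] Ball_def)
qed

text \<open>The ambient subspace is itself closed, so relative closedness splits into plain
  closedness and containment; containment is the vanishing of y from r on and of z from s
  on.\<close>

lemma micp_set_iff_closed:
  fixes S :: "'a::euclidean_space set"
  shows "micp_set S \<longleftrightarrow>
    (\<exists>(r::nat) (s::nat) M. closed M \<and> convex_triples M \<and>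
        (\<forall>x y z. (x, y, z) \<in> M \<longrightarrow> (\<forall>j\<ge>r. y j = 0) \<and> (\<forall>j\<ge>s. z j = 0)) \<and>
        (\<forall>x. x \<in> S \<longleftrightarrow> (\<exists>y z. (\<forall>j<s. z j \<in> \<int>) \<and> (x, y, z) \<in> M)))"
proof -
  have *: "closedin (prod_topology euclidean (prod_topology (Euclidean_space r) (Euclidean_space s))) M
      \<longleftrightarrow> closed M \<and> (\<forall>x y z. (x, y, z) \<in> M \<longrightarrow> (\<forall>j\<ge>r. y j = 0) \<and> (\<forall>j\<ge>s. z j = 0))"
    for r s and M :: "('a \<times> (nat \<Rightarrow> real) \<times> (nat \<Rightarrow> real)) set"
    unfolding prod_topology_Euclidean_space
    by (subst closedin_closed_eq) (auto intro!: closed_Times closed_zero_from)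
  show ?thesis
    unfolding micp_set_def * by (simp add: conj_ac)
qed

lemma micp_setI:
  fixes S :: "'a::euclidean_space set"
  assumes "closed M" "convex_triples M"
    and "\<And>x y z j. (x, y, z) \<in> M \<Longrightarrow> j \<ge> r \<Longrightarrow> y j = 0"
    and "\<And>x y z j. (x, y, z) \<in> M \<Longrightarrow> j \<ge> s \<Longrightarrow> z j = 0"
    and "\<And>x. x \<in> S \<longleftrightarrow> (\<exists>y z. (\<forall>j<s. z j \<in> \<int>) \<and> (x, y, z) \<in> M)"
  shows "micp_set S"
  unfolding micp_set_iff_closed
  by (rule exI[of _ r], rule exI[of _ s], rule exI[of _ M]) (use assms in blast)

lemma micp_setE:
  fixes S :: "'a::euclidean_space set"
  assumes "micp_set S"
  obtains r s M where "closed M" "convex_triples M"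
    "\<And>x y z j. (x, y, z) \<in> M \<Longrightarrow> j \<ge> r \<Longrightarrow> y j = 0"
    "\<And>x y z j. (x, y, z) \<in> M \<Longrightarrow> j \<ge> s \<Longrightarrow> z j = 0"
    "\<And>x. x \<in> S \<longleftrightarrow> (\<exists>y z. (\<forall>j<s. z j \<in> \<int>) \<and> (x, y, z) \<in> M)"
  using assms unfolding micp_set_iff_closed by blast

lemma convex_triplesD:
  assumes "convex_triples M" "(x, y, z) \<in> M" "(x', y', z') \<in> M" "0 \<le> u" "0 \<le> v" "u + v = 1"
  shows "(u *\<^sub>R x + v *\<^sub>R x', (\<lambda>j. u * y j + v * y' j), (\<lambda>j. u * z j + v * z' j)) \<in> M"
  using assms unfolding convex_triples_def by blast

section \<open>Elementary representable sets\<close>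

lemma micp_set_closed_convex:
  fixes S :: "'a::euclidean_space set"
  assumes "closed S" "convex S"
  shows "micp_set S"
proof (rule micp_setI[where r = 0 and s = 0 and M = "S \<times> {y. \<forall>j\<ge>0. y j = 0} \<times> {z. \<forall>j\<ge>0. z j = 0}"])
  show "convex_triples (S \<times> {y :: nat \<Rightarrow> real. \<forall>j\<ge>0. y j = 0} \<times> {z :: nat \<Rightarrow> real. \<forall>j\<ge>0. z j = 0})"
    using assms(2) by (auto simp: convex_triples_def convex_def)
  show "closed (S \<times> {y :: nat \<Rightarrow> real. \<forall>j\<ge>0. y j = 0} \<times> {z :: nat \<Rightarrow> real. \<forall>j\<ge>0. z j = 0})"
    by (intro closed_Times assms closed_zero_from)
qed auto

text \<open>A single integer variable \<open>z 0\<close> is forced to equal x. The set M is a linear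
  subspace, and all nonconvexity comes from the integrality demand on \<open>z 0\<close>.\<close>

lemma micp_set_Ints: "micp_set (\<int> :: real set)"
proof -
  let ?M = "{(x :: real, y :: nat \<Rightarrow> real, z :: nat \<Rightarrow> real).
    (\<forall>j. y j = 0) \<and> z 0 = x \<and> (\<forall>j\<ge>1. z j = 0)}"
  show ?thesis
  proof (rule micp_setI[where r = 0 and s = 1 and M = ?M])
    have "continuous_on UNIV (\<lambda>w :: real \<times> (nat \<Rightarrow> real) \<times> (nat \<Rightarrow> real). snd (snd w) 0)"
      by (rule continuous_on_product_then_coordinatewise) (intro continuous_intros)
    then have "closed ({w. snd (snd w) 0 = fst w} \<inter>
        UNIV \<times> {y :: nat \<Rightarrow> real. \<forall>j\<ge>0. y j = 0} \<times> {z :: nat \<Rightarrow> real. \<forall>j\<ge>1. z j = 0})"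
      by (intro closed_Int closed_Collect_eq closed_Times closed_zero_from continuous_intros) auto
    then show "closed ?M"
      by (rule back_subst[of closed]) auto
    show "x \<in> \<int> \<longleftrightarrow> (\<exists>y z. (\<forall>j<1. z j \<in> \<int>) \<and> (x, y, z) \<in> ?M)" for x
    proof
      assume "x \<in> \<int>"
      then have "(\<forall>j<1. (if j = 0 then x else 0) \<in> \<int>) \<and> (x, \<lambda>_. 0, \<lambda>j. if j = 0 then x else 0) \<in> ?M"
        by auto
      then show "\<exists>y z. (\<forall>j<1. z j \<in> \<int>) \<and> (x, y, z) \<in> ?M"
        by (intro exI)
    qed auto
  qed (auto simp: convex_triples_def)
qed

section \<open>Affine preimages, intersections and projections\<close>

lemma micp_set_affine_vimage:
  fixes L :: "'a::euclidean_space \<Rightarrow> 'b::euclidean_space"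
  assumes "linear L" "micp_set S"
  shows "micp_set {x. L x + c \<in> S}"
proof -
  obtain r s M where M: "closed M" "convex_triples M"
    "\<And>x y z j. (x, y, z) \<in> M \<Longrightarrow> j \<ge> r \<Longrightarrow> y j = 0"
    "\<And>x y z j. (x, y, z) \<in> M \<Longrightarrow> j \<ge> s \<Longrightarrow> z j = 0"
    "\<And>x. x \<in> S \<longleftrightarrow> (\<exists>y z. (\<forall>j<s. z j \<in> \<int>) \<and> (x, y, z) \<in> M)"
    using assms(2) by (rule micp_setE) blast
  let ?M = "{(x, y, z). (L x + c, y, z) \<in> M}"
  show ?thesis
  proof (rule micp_setI[where r = r and s = s and M = ?M])
    \<comment> \<open>Closedness is obtained for a preimage under a continuous map and then carried
      over to the set-builder form of the same set.\<close>
    have "closed ((\<lambda>w. (L (fst w) + c, fst (snd w), snd (snd w))) -` M)"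
      by (intro closed_vimage M(1) continuous_intros
          continuous_on_compose2[OF linear_continuous_on[OF linear_conv_bounded_linear[THEN iffD1, OF assms(1)]]])
        auto
    then show "closed ?M"
      by (rule back_subst[of closed]) auto
    show "convex_triples ?M"
      unfolding convex_triples_def
    proof (clarify)
      fix x y z x' y' z' and u v :: real
      assume "(L x + c, y, z) \<in> M" "(L x' + c, y', z') \<in> M" and uv: "0 \<le> u" "0 \<le> v" "u + v = 1"
      then have "(u *\<^sub>R (L x + c) + v *\<^sub>R (L x' + c),
          (\<lambda>j. u * y j + v * y' j), (\<lambda>j. u * z j + v * z' j)) \<in> M"
        by (intro convex_triplesD M(2))
      \<comment> \<open>The offset survives convex combinations because its total weight is u + v =
        1.\<close>
      moreover have "u *\<^sub>R (L x + c) + v *\<^sub>R (L x' + c) = L (u *\<^sub>R x + v *\<^sub>R x') + (u + v) *\<^sub>R c"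
        using assms(1) by (simp add: linear_add linear_scale algebra_simps)
      ultimately show "(L (u *\<^sub>R x + v *\<^sub>R x') + c,
          (\<lambda>j. u * y j + v * y' j), (\<lambda>j. u * z j + v * z' j)) \<in> M"
        using uv by simp
    qed
  qed (use M(3-5) in auto)
qed

lemma micp_set_linear_vimage:
  fixes L :: "'a::euclidean_space \<Rightarrow> 'b::euclidean_space"
  assumes "linear L" "micp_set S"
  shows "micp_set {x. L x \<in> S}"
  using micp_set_affine_vimage[OF assms, of 0] by simp

text \<open>Both representations are imposed on the same x, each with its own auxiliary variables;
  the two blocks of variables are concatenated.\<close>

lemma micp_set_Int:
  fixes S T :: "'a::euclidean_space set"
  assumes "micp_set S" "micp_set T"
  shows "micp_set (S \<inter> T)"
proof -
  obtain r s M where M: "closed M" "convex_triples M"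
    "\<And>x y z j. (x, y, z) \<in> M \<Longrightarrow> j \<ge> r \<Longrightarrow> y j = 0"
    "\<And>x y z j. (x, y, z) \<in> M \<Longrightarrow> j \<ge> s \<Longrightarrow> z j = 0"
    "\<And>x. x \<in> S \<longleftrightarrow> (\<exists>y z. (\<forall>j<s. z j \<in> \<int>) \<and> (x, y, z) \<in> M)"
    using assms(1) by (rule micp_setE) blast
  obtain r' s' M' where M': "closed M'" "convex_triples M'"
    "\<And>x y z j. (x, y, z) \<in> M' \<Longrightarrow> j \<ge> r' \<Longrightarrow> y j = 0"
    "\<And>x y z j. (x, y, z) \<in> M' \<Longrightarrow> j \<ge> s' \<Longrightarrow> z j = 0"
    "\<And>x. x \<in> T \<longleftrightarrow> (\<exists>y z. (\<forall>j<s'. z j \<in> \<int>) \<and> (x, y, z) \<in> M')"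
    using assms(2) by (rule micp_setE) blast
  \<comment> \<open>\<open>pre k\<close> reads off the first block and pads it with zeros,
    \<open>suf k\<close> reads off the second by a shift, and \<open>app k\<close> glues blocks.
    Padding loses nothing, since the first block of a point of M vanishes from its length
    on.\<close>
  define pre where "pre k y j = (if j < k then y j else 0)" for k j :: nat and y :: "nat \<Rightarrow> real"
  define suf where "suf k y j = y (j + k)" for k j :: nat and y :: "nat \<Rightarrow> real"
  define app where "app k y y' j = (if j < k then y j else y' (j - k))"
    for k j :: nat and y y' :: "nat \<Rightarrow> real"
  have pre_app: "pre k (app k y y') = y" if "\<And>j. j \<ge> k \<Longrightarrow> y j = 0" for k y y'
    using that by (auto simp: pre_def app_def fun_eq_iff)
  have suf_app: "suf k (app k y y') = y'" for k y y'
    by (auto simp: suf_def app_def)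
  let ?N = "{(x, y, z). (x, pre r y, pre s z) \<in> M \<and> (x, suf r y, suf s z) \<in> M'}"
  show ?thesis
  proof (rule micp_setI[where r = "r + r'" and s = "s + s'" and M = ?N])
    \<comment> \<open>Continuity into the product is coordinatewise; every coordinate of
      \<open>pre k\<close> and \<open>suf k\<close> is a coordinate projection or zero.\<close>
    have cont: "continuous_on UNIV (pre k)" "continuous_on UNIV (suf k)" for k
    proof -
      show "continuous_on UNIV (pre k)"
      proof (rule continuous_on_coordinatewise_then_product)
        show "continuous_on UNIV (\<lambda>y. pre k y i)" for i
          by (cases "i < k") (auto simp: pre_def intro: continuous_on_product_coordinates)
      qed
      show "continuous_on UNIV (suf k)"
        unfolding suf_def
        by (intro continuous_on_coordinatewise_then_product continuous_on_product_coordinates)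
    qed
    have pre: "continuous_on A (\<lambda>w. pre k (f w))" and suf: "continuous_on A (\<lambda>w. suf k (f w))"
      if "continuous_on A f" for A k and f :: "'a \<times> (nat \<Rightarrow> real) \<times> (nat \<Rightarrow> real) \<Rightarrow> _"
      by (rule continuous_on_compose2[OF cont(1) that] continuous_on_compose2[OF cont(2) that]; simp)+
    have "closed ((\<lambda>w. (fst w, pre r (fst (snd w)), pre s (snd (snd w)))) -` M \<inter>
        (\<lambda>w. (fst w, suf r (fst (snd w)), suf s (snd (snd w)))) -` M')"
      by (intro closed_Int closed_vimage M(1) M'(1) continuous_intros pre suf)
    then show "closed ?N"
      by (rule back_subst[of closed]) auto
    show "convex_triples ?N"
      unfolding convex_triples_def
    proof (clarify, intro conjI)
      fix x y z x' y' z' and u v :: real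
      assume uv: "0 \<le> u" "0 \<le> v" "u + v = 1"
      have lin: "pre k (\<lambda>j. u * y j + v * y' j) = (\<lambda>j. u * pre k y j + v * pre k y' j)"
        "suf k (\<lambda>j. u * y j + v * y' j) = (\<lambda>j. u * suf k y j + v * suf k y' j)" for k y y'
        by (auto simp: pre_def suf_def)
      show "(u *\<^sub>R x + v *\<^sub>R x', pre r (\<lambda>j. u * y j + v * y' j), pre s (\<lambda>j. u * z j + v * z' j)) \<in> M"
        if "(x, pre r y, pre s z) \<in> M" "(x', pre r y', pre s z') \<in> M"
        unfolding lin using that uv by (intro convex_triplesD M(2))
      show "(u *\<^sub>R x + v *\<^sub>R x', suf r (\<lambda>j. u * y j + v * y' j), suf s (\<lambda>j. u * z j + v * z' j)) \<in> M'"
        if "(x, suf r y, suf s z) \<in> M'" "(x', suf r y', suf s z') \<in> M'"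
        unfolding lin using that uv by (intro convex_triplesD M'(2))
    qed
    show "x \<in> S \<inter> T \<longleftrightarrow> (\<exists>y z. (\<forall>j<s + s'. z j \<in> \<int>) \<and> (x, y, z) \<in> ?N)" for x
    proof
      assume "x \<in> S \<inter> T"
      then obtain y z y' z' where *: "\<forall>j<s. z j \<in> \<int>" "(x, y, z) \<in> M"
          "\<forall>j<s'. z' j \<in> \<int>" "(x, y', z') \<in> M'"
        using M(5) M'(5) by auto
      have "pre r (app r y y') = y"
        by (rule pre_app) (rule M(3)[OF *(2)])
      moreover have "pre s (app s z z') = z"
        by (rule pre_app) (rule M(4)[OF *(2)])
      moreover have "app s z z' j \<in> \<int>" if "j < s + s'" for j
        using that * by (auto simp: app_def)
      ultimately show "\<exists>y z. (\<forall>j<s + s'. z j \<in> \<int>) \<and> (x, y, z) \<in> ?N"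
        using * by (intro exI[of _ "app r y y'"] exI[of _ "app s z z'"]) (auto simp: suf_app)
    next
      assume "\<exists>y z. (\<forall>j<s + s'. z j \<in> \<int>) \<and> (x, y, z) \<in> ?N"
      then obtain y z where *: "\<forall>j<s + s'. z j \<in> \<int>"
          "(x, pre r y, pre s z) \<in> M" "(x, suf r y, suf s z) \<in> M'"
        by auto
      moreover have "\<forall>j<s. pre s z j \<in> \<int>" "\<forall>j<s'. suf s z j \<in> \<int>"
        using *(1) by (auto simp: pre_def suf_def)
      ultimately show "x \<in> S \<inter> T"
        using M(5) M'(5) by blast
    qed
    fix x y z j assume "(x, y, z) \<in> ?N"
    then have N: "(x, suf r y, suf s z) \<in> M'" by simp
    \<comment> \<open>An index past both blocks lies in the shifted part, at position j - r, where
      M' already forces zero.\<close>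
    show "y j = 0" if "j \<ge> r + r'"
      using M'(3)[OF N, of "j - r"] that by (simp add: suf_def)
    show "z j = 0" if "j \<ge> s + s'"
      using M'(4)[OF N, of "j - s"] that by (simp add: suf_def)
  qed
qed

lemma micp_set_INT:
  fixes S :: "'i \<Rightarrow> 'a::euclidean_space set"
  assumes "finite I" "\<And>i. i \<in> I \<Longrightarrow> micp_set (S i)"
  shows "micp_set (\<Inter>i\<in>I. S i)"
  using assms
proof (induction I rule: finite_induct)
  case empty
  show ?case by (simp add: micp_set_closed_convex)
next
  case (insert i I)
  then show ?case by (simp add: micp_set_Int)
qed

text \<open>The eliminated vector b becomes \<open>DIM('b)\<close> further continuous variables,
  stored in front of the old ones.\<close>

lemma micp_set_proj:
  fixes S :: "('a::euclidean_space \<times> 'b::euclidean_space) set"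
  assumes "micp_set S"
  shows "micp_set {x. \<exists>b. (x, b) \<in> S}"
proof -
  obtain r s M where M: "closed M" "convex_triples M"
    "\<And>x y z j. (x, y, z) \<in> M \<Longrightarrow> j \<ge> r \<Longrightarrow> y j = 0"
    "\<And>x y z j. (x, y, z) \<in> M \<Longrightarrow> j \<ge> s \<Longrightarrow> z j = 0"
    "\<And>x. x \<in> S \<longleftrightarrow> (\<exists>y z. (\<forall>j<s. z j \<in> \<int>) \<and> (x, y, z) \<in> M)"
    using assms by (rule micp_setE) blast
  define n where "n = DIM('b)"
  \<comment> \<open>Enumerating the basis by numbers below n lets \<open>vec\<close> rebuild b from
    the first n entries; \<open>app\<close> stores its coordinates there.\<close>
  obtain e :: "nat \<Rightarrow> 'b" where e: "bij_betw e {..<n} Basis"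
    unfolding n_def using ex_bij_betw_nat_finite[OF finite_Basis] atLeast0LessThan by metis
  define vec where "vec y = (\<Sum>j<n. y j *\<^sub>R e j)" for y :: "nat \<Rightarrow> real"
  define suf where "suf y j = y (j + n)" for j :: nat and y :: "nat \<Rightarrow> real"
  define app where "app b y j = (if j < n then b \<bullet> e j else y (j - n))"
    for j :: nat and b and y :: "nat \<Rightarrow> real"
  have vec_app: "vec (app b y) = b" for b y
  proof -
    have "vec (app b y) = (\<Sum>j<n. (b \<bullet> e j) *\<^sub>R e j)"
      by (simp add: vec_def app_def)
    also have "\<dots> = (\<Sum>i\<in>Basis. (b \<bullet> i) *\<^sub>R i)"
      using e by (rule sum.reindex_bij_betw)
    finally show ?thesis
      by (simp add: euclidean_representation)
  qed
  have suf_app: "suf (app b y) = y" for b y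
    by (auto simp: suf_def app_def)
  let ?N = "{(x, y, z). ((x, vec y), suf y, z) \<in> M}"
  show ?thesis
  proof (rule micp_setI[where r = "n + r" and s = s and M = ?N])
    have cont: "continuous_on UNIV vec" "continuous_on UNIV suf"
      unfolding vec_def suf_def
      by (intro continuous_on_sum continuous_on_scaleR continuous_on_const
          continuous_on_coordinatewise_then_product continuous_on_product_coordinates)+
    have vec: "continuous_on A (\<lambda>w. vec (f w))" and suf: "continuous_on A (\<lambda>w. suf (f w))"
      if "continuous_on A f" for A and f :: "'a \<times> (nat \<Rightarrow> real) \<times> (nat \<Rightarrow> real) \<Rightarrow> _"
      by (rule continuous_on_compose2[OF cont(1) that] continuous_on_compose2[OF cont(2) that]; simp)+
    have "closed ((\<lambda>w. ((fst w, vec (fst (snd w))), suf (fst (snd w)), snd (snd w))) -` M)"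
      by (intro closed_vimage M(1) continuous_intros vec suf)
    then show "closed ?N"
      by (rule back_subst[of closed]) auto
    show "convex_triples ?N"
      unfolding convex_triples_def
    proof (clarify)
      fix x y z x' y' z' and u v :: real
      assume uv: "0 \<le> u" "0 \<le> v" "u + v = 1"
        and *: "((x, vec y), suf y, z) \<in> M" "((x', vec y'), suf y', z') \<in> M"
      have "suf (\<lambda>j. u * y j + v * y' j) = (\<lambda>j. u * suf y j + v * suf y' j)"
        by (auto simp: suf_def)
      moreover have "vec (\<lambda>j. u * y j + v * y' j) = u *\<^sub>R vec y + v *\<^sub>R vec y'"
        by (simp add: vec_def scaleR_add_left sum.distrib scaleR_sum_right)
      ultimately show "((u *\<^sub>R x + v *\<^sub>R x', vec (\<lambda>j. u * y j + v * y' j)),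
          suf (\<lambda>j. u * y j + v * y' j), (\<lambda>j. u * z j + v * z' j)) \<in> M"
        using convex_triplesD[OF M(2) * uv] by simp
    qed
    show "x \<in> {x. \<exists>b. (x, b) \<in> S} \<longleftrightarrow> (\<exists>y z. (\<forall>j<s. z j \<in> \<int>) \<and> (x, y, z) \<in> ?N)" for x
      unfolding mem_Collect_eq M(5) by (auto; metis vec_app suf_app)
    fix x y z j assume "(x, y, z) \<in> ?N"
    then have N: "((x, vec y), suf y, z) \<in> M" by simp
    show "y j = 0" if "j \<ge> n + r"
      using M(3)[OF N, of "j - n"] that by (simp add: suf_def)
    show "z j = 0" if "j \<ge> s"
      using M(4)[OF N that] .
  qed
qed

section \<open>Rotated cones and finite unions\<close>

text \<open>The constraint \<open>\<parallel>u\<parallel>\<^sup>2 \<le> v l\<close> with \<open>v, l \<ge> 0\<close>, written so that it is visibly convex.\<close>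

definition rotated_cone :: "('a::euclidean_space \<times> real \<times> real) set" where
  "rotated_cone = {(u, v, l). norm (2 *\<^sub>R u, v - l) \<le> v + l}"

text \<open>Square both sides and use (v + l)^2 - (v - l)^2 = 4 v l. The signs of v and l follow
  because their product and their sum are both nonnegative.\<close>

lemma mem_rotated_cone:
  "(u, v, l) \<in> rotated_cone \<longleftrightarrow> 0 \<le> v \<and> 0 \<le> l \<and> (norm u)\<^sup>2 \<le> v * l"
proof -
  have "(u, v, l) \<in> rotated_cone \<longleftrightarrow> 0 \<le> v + l \<and> (norm (2 *\<^sub>R u, v - l))\<^sup>2 \<le> (v + l)\<^sup>2"
    unfolding rotated_cone_def
    by (simp) (metis norm_ge_zero order_trans power2_le_imp_le power_mono)
  also have "\<dots> \<longleftrightarrow> 0 \<le> v + l \<and> 4 * (norm u)\<^sup>2 + (v - l)\<^sup>2 \<le> (v + l)\<^sup>2"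
    by (simp add: norm_Pair power_mult_distrib)
  also have "\<dots> \<longleftrightarrow> 0 \<le> v + l \<and> (norm u)\<^sup>2 \<le> v * l"
    by (auto simp: power2_eq_square algebra_simps)
  also have "\<dots> \<longleftrightarrow> 0 \<le> v \<and> 0 \<le> l \<and> (norm u)\<^sup>2 \<le> v * l"
  proof (intro iffI conjI; (elim conjE)?)
    assume *: "0 \<le> v + l" "(norm u)\<^sup>2 \<le> v * l"
    then have "0 \<le> v * l"
      using zero_le_power2 order_trans by blast
    with *(1) show "0 \<le> v" "0 \<le> l"
      by (auto simp: zero_le_mult_iff)
  qed auto
  finally show ?thesis .
qed

text \<open>The norm of a linear expression is bounded by a linear one, so convexity is the triangle
  inequality.\<close>

lemma micp_set_rotated_cone: "micp_set (rotated_cone :: ('a::euclidean_space \<times> real \<times> real) set)"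
proof (rule micp_set_closed_convex)
  show "closed (rotated_cone :: ('a \<times> real \<times> real) set)"
    unfolding rotated_cone_def case_prod_beta by (intro closed_Collect_le continuous_intros)
  show "convex (rotated_cone :: ('a \<times> real \<times> real) set)"
  proof (rule convexI, clarify)
    fix u u' :: 'a and v l v' l' a b :: real
    assume "0 \<le> a" "0 \<le> b" "(u, v, l) \<in> rotated_cone" "(u', v', l') \<in> rotated_cone"
    then have le: "norm (2 *\<^sub>R u, v - l) \<le> v + l" "norm (2 *\<^sub>R u', v' - l') \<le> v' + l'"
      by (auto simp: rotated_cone_def)
    have "norm (2 *\<^sub>R (a *\<^sub>R u + b *\<^sub>R u'), a * v + b * v' - (a * l + b * l'))
        = norm (a *\<^sub>R (2 *\<^sub>R u, v - l) + b *\<^sub>R (2 *\<^sub>R u', v' - l'))"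
      by (simp add: algebra_simps)
    also have "\<dots> \<le> a * norm (2 *\<^sub>R u, v - l) + b * norm (2 *\<^sub>R u', v' - l')"
      using \<open>0 \<le> a\<close> \<open>0 \<le> b\<close> by (metis abs_of_nonneg norm_scaleR norm_triangle_ineq)
    also have "\<dots> \<le> a * (v + l) + b * (v' + l')"
      using \<open>0 \<le> a\<close> \<open>0 \<le> b\<close> le by (intro add_mono mult_left_mono)
    finally show "a *\<^sub>R (u, v, l) + b *\<^sub>R (u', v', l') \<in> rotated_cone"
      by (simp add: rotated_cone_def algebra_simps)
  qed
qed

lemma micp_set_Un:
  fixes S T :: "'a::euclidean_space set"
  assumes "micp_set S" "micp_set T"
  shows "micp_set (S \<union> T)"
\<comment> \<open>The encoding asks for a point of each set, so an empty set is split off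
  first.\<close>
proof (cases "S = {} \<or> T = {}")
  case True
  then show ?thesis using assms by auto
next
  case False
  then obtain s t where st: "s \<in> S" "t \<in> T" by blast
  \<comment> \<open>Here w is (x, a, b, v, l). The offset (0, 0, 1) turns -l into 1 - l, which makes
    the last condition an affine preimage.\<close>
  have "micp_set ({w. fst (snd w) \<in> S} \<inter> {w. fst (snd (snd w)) \<in> T} \<inter>
      {w. snd (snd (snd (snd w))) \<in> \<int>} \<inter>
      {w. (fst w - fst (snd w), fst (snd (snd (snd w))), snd (snd (snd (snd w)))) \<in> rotated_cone} \<inter>
      {w. (fst w - fst (snd (snd w)), fst (snd (snd (snd w))), - snd (snd (snd (snd w))))
         + (0, 0, 1) \<in> rotated_cone})"
    (is "micp_set ?W")
    by (intro micp_set_Int micp_set_linear_vimage micp_set_affine_vimage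
        assms micp_set_Ints micp_set_rotated_cone linearI)
       (auto simp: algebra_simps)
  then have "micp_set {x. \<exists>w :: 'a \<times> 'a \<times> real \<times> real. (x, w) \<in> ?W}"
    by (rule micp_set_proj)
  moreover have "(\<exists>w. (x, w) \<in> ?W) \<longleftrightarrow> x \<in> S \<union> T" for x
  proof
    assume "\<exists>w. (x, w) \<in> ?W"
    then obtain a b v l where w: "a \<in> S" "b \<in> T" "l \<in> \<int>"
        "(x - a, v, l) \<in> rotated_cone" "(x - b, v, 1 - l) \<in> rotated_cone"
      by auto
    then have "0 \<le> l" "l \<le> 1" "(norm (x - a))\<^sup>2 \<le> v * l" "(norm (x - b))\<^sup>2 \<le> v * (1 - l)"
      by (auto simp: mem_rotated_cone)
    \<comment> \<open>If l = 0 the first cone collapses to x = a, and if l = 1 the second collapses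
      to x = b.\<close>
    moreover have "l = 0 \<or> l = 1"
      using \<open>l \<in> \<int>\<close> \<open>0 \<le> l\<close> \<open>l \<le> 1\<close> by (auto elim!: Ints_cases)
    ultimately show "x \<in> S \<union> T"
      using w(1,2) by auto
  next
    assume "x \<in> S \<union> T"
    then show "\<exists>w. (x, w) \<in> ?W"
    proof
      assume "x \<in> S"
      \<comment> \<open>With l = 0 the point t of T is arbitrary, and v is its squared distance from
        x, just enough slack for the second cone. The other case is symmetric with l = 1.\<close>
      then have "(x, x, t, (norm (x - t))\<^sup>2, 0) \<in> ?W"
        using st by (auto simp: mem_rotated_cone)
      then show ?thesis by blast
    next
      assume "x \<in> T"
      then have "(x, s, x, (norm (x - s))\<^sup>2, 1) \<in> ?W"
        using st by (auto simp: mem_rotated_cone)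
      then show ?thesis by blast
    qed
  qed
  ultimately show ?thesis by (simp only: Collect_mem_eq)
qed

lemma micp_set_UN:
  fixes S :: "'i \<Rightarrow> 'a::euclidean_space set"
  assumes "finite I" "\<And>i. i \<in> I \<Longrightarrow> micp_set (S i)"
  shows "micp_set (\<Union>i\<in>I. S i)"
  using assms
proof (induction I rule: finite_induct)
  case empty
  show ?case by (simp add: micp_set_closed_convex)
next
  case (insert i I)
  then show ?case by (simp add: micp_set_Un)
qed

subsection \<open>The favorable objective\<close>

text \<open>Each term gets its own upper bound \<open>\<tau> $ i\<close>. Nonnegative weights make
  the weighted sum of the bounds dominate that of the values, and the bounds are then projected
  away.\<close>

lemma micp_set_epigraph_sum:
  fixes X :: "'a::euclidean_space set" and f :: "'N::finite \<Rightarrow> 'a \<Rightarrow> real" and c :: "real^'N"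
  assumes "\<And>i. micp_set (epigraph X (f i))" "\<And>i. 0 \<le> c $ i"
  shows "micp_set (epigraph X (\<lambda>x. \<Sum>i\<in>UNIV. c $ i * f i x))"
proof -
  \<comment> \<open>Here w is ((x, t), \<tau>), and the last set is the half-space where the
    weighted sum of the bounds is at most t.\<close>
  have "micp_set ((\<Inter>i\<in>UNIV. {w. (fst (fst w), snd w $ i) \<in> epigraph X (f i)}) \<inter>
      {w. c \<bullet> snd w - snd (fst w) \<in> {..0}})"
    (is "micp_set ?W")
    by (intro micp_set_Int micp_set_INT micp_set_linear_vimage assms micp_set_closed_convex linearI)
       (auto simp: algebra_simps inner_add_right)
  then have "micp_set {w. \<exists>\<tau> :: real^'N. (w, \<tau>) \<in> ?W}"
    by (rule micp_set_proj)
  moreover have "(\<exists>\<tau>. ((x, t), \<tau>) \<in> ?W) \<longleftrightarrow> (x, t) \<in> epigraph X (\<lambda>x. \<Sum>i\<in>UNIV. c $ i * f i x)"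
    for x t
  proof
    assume "\<exists>\<tau>. ((x, t), \<tau>) \<in> ?W"
    then obtain \<tau> where \<tau>: "\<And>i. x \<in> X \<and> f i x \<le> \<tau> $ i" "c \<bullet> \<tau> \<le> t"
      by (auto simp: epigraph_def)
    have "(\<Sum>i\<in>UNIV. c $ i * f i x) \<le> c \<bullet> \<tau>"
      unfolding inner_vec_def inner_real_def using \<tau> assms(2) by (intro sum_mono mult_left_mono) auto
    then show "(x, t) \<in> epigraph X (\<lambda>x. \<Sum>i\<in>UNIV. c $ i * f i x)"
      using \<tau> by (auto simp: epigraph_def)
  next
    assume "(x, t) \<in> epigraph X (\<lambda>x. \<Sum>i\<in>UNIV. c $ i * f i x)"
    then have "((x, t), \<chi> i. f i x) \<in> ?W"
      by (auto simp: epigraph_def inner_vec_def)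
    then show "\<exists>\<tau>. ((x, t), \<tau>) \<in> ?W" ..
  qed
  ultimately show ?thesis by (simp add: set_eq_iff[symmetric])
qed

text \<open>It is cut out by finitely many half-spaces and a hyperplane. Its points are nonnegative
  with l1 norm 1, and the l1 norm dominates the Euclidean norm.\<close>

lemma polytope_ambiguity_set:
  fixes D :: "real^'N::finite^'l::finite"
  shows "polytope (ambiguity_set D d)"
  unfolding polytope_eq_bounded_polyhedron
proof
  have "ambiguity_set D d = (\<Inter>i\<in>UNIV. {p. axis i 1 \<bullet> p \<ge> 0}) \<inter>
      (\<Inter>k\<in>UNIV. {p. row k D \<bullet> p \<le> d $ k}) \<inter> {p. (\<chi> i. 1) \<bullet> p = 1}"
    by (auto simp: ambiguity_set_def less_eq_vec_def inner_axis' matrix_vector_mul_component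
        row_def inner_vec_def[of "\<chi> i. 1"])
  then show "polyhedron (ambiguity_set D d)"
    by (auto intro!: polyhedron_Int polyhedron_Inter polyhedron_halfspace_le
        polyhedron_halfspace_ge polyhedron_hyperplane)
  show "bounded (ambiguity_set D d)"
  proof (rule boundedI)
    fix p assume "p \<in> ambiguity_set D d"
    then have "\<And>i. 0 \<le> p $ i" "(\<Sum>i\<in>UNIV. p $ i) = 1"
      by (auto simp: ambiguity_set_def less_eq_vec_def)
    then show "norm p \<le> 1"
      using norm_le_l1_cart[of p] by simp
  qed
qed

text \<open>The half-space where the functional is at least its minimum m over V is convex and
  contains V, hence the hull. So m is the minimum over the hull too, and a bound on the infimum
  becomes a finite disjunction.\<close>

lemma cINF_inner_convex_hull_le_iff:
  fixes q :: "'a::euclidean_space"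
  assumes "finite V" "V \<noteq> {}"
  shows "(INF p\<in>convex hull V. q \<bullet> p) \<le> t \<longleftrightarrow> (\<exists>v\<in>V. q \<bullet> v \<le> t)"
proof -
  define m where "m = Min ((\<bullet>) q ` V)"
  have m: "m \<in> (\<bullet>) q ` V" "\<And>v. v \<in> V \<Longrightarrow> m \<le> q \<bullet> v"
    using assms by (auto simp: m_def)
  have "convex hull V \<subseteq> {p. q \<bullet> p \<ge> m}"
    by (rule hull_minimal) (use m in \<open>auto simp: convex_halfspace_ge\<close>)
  then have "(INF p\<in>convex hull V. q \<bullet> p) = m"
    using m(1) by (intro cInf_eq_minimum) (auto intro: hull_inc)
  then show ?thesis
    using m by force
qed

theorem theorem6:
  fixes X :: "(real^'n) set"
    and Q :: "real^'n \<Rightarrow> real^'m \<Rightarrow> real"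
    and \<xi> :: "'N::finite \<Rightarrow> real^'m"
    and D :: "real^'N^'l"
    and d :: "real^'l"
  assumes "compact X"
    and "rel_interior X \<noteq> {}"
    and "micp_set X"
    and "\<And>i. micp_fun X (\<lambda>x. Q x (\<xi> i))"
  shows "micp_program (dfo_feasible X D d) (dfo_objective Q \<xi> D d)"
proof (cases "ambiguity_set D d = {}")
  \<comment> \<open>Feasible region and epigraph are both empty, and the empty set is closed and
    convex.\<close>
  case True
  then show ?thesis
    by (auto simp: micp_program_def micp_fun_def dfo_feasible_def epigraph_def
        intro: micp_set_closed_convex)
next
  case False
  obtain V where V: "finite V" "ambiguity_set D d = convex hull V"
    using polytope_ambiguity_set unfolding polytope_def by blast
  \<comment> \<open>The objective is a pointwise minimum over the finite set V, so its epigraph is a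
    union of epigraphs.\<close>
  have "epigraph X (dfo_objective Q \<xi> D d) =
      (\<Union>v\<in>V. epigraph X (\<lambda>x. \<Sum>i\<in>UNIV. v $ i * Q x (\<xi> i)))"
  proof -
    have "dfo_objective Q \<xi> D d x = (INF p\<in>convex hull V. (\<chi> i. Q x (\<xi> i)) \<bullet> p)" for x
      by (simp add: dfo_objective_def V(2) inner_vec_def mult.commute)
    moreover have "V \<noteq> {}"
      using False V(2) by auto
    ultimately show ?thesis
      using V(1) by (simp add: epigraph_def cINF_inner_convex_hull_le_iff)
        (auto simp: inner_vec_def mult.commute)
  qed
  moreover have "micp_set (epigraph X (\<lambda>x. \<Sum>i\<in>UNIV. v $ i * Q x (\<xi> i)))" if "v \<in> V" for v
  proof (rule micp_set_epigraph_sum)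
    \<comment> \<open>Generators of the hull are themselves probability vectors, which supplies the
      nonnegative weights.\<close>
    have "v \<in> ambiguity_set D d"
      using that V(2) by (simp add: hull_inc)
    then show "0 \<le> v $ i" for i
      by (simp add: ambiguity_set_def less_eq_vec_def)
  qed (use assms(4) in \<open>simp add: micp_fun_def\<close>)
  ultimately have "micp_set (epigraph X (dfo_objective Q \<xi> D d))"
    using V(1) by (simp add: micp_set_UN)
  then show ?thesis
    using False assms(3) by (simp add: micp_program_def micp_fun_def dfo_feasible_eq)
qed

end
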